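(* For all sufficiently large $n\in\mathbb N$: (1) for every function $f\colon\{0,1\}^n\to\{0,1\}$ that is not identically $0$, there exist $\epsilon\in(0,1]$ and a CNF formula of size at most $\epsilon 2^{n+3}/n$ that approximates $f$ with one-sided error and advantage $\epsilon$; (2) there exists a function $f\colon\{0,1\}^n\to\{0,1\}$ such that, for every $\epsilon\in(0,1]$, every CNF formula approximating $f$ with one-sided error and advantage $\epsilon$ has size at least $\epsilon 2^{n-7}/n$.
   Context: A CNF formula is an AND of clauses (ORs of literals); its size is its number of clauses. A CNF formula $\phi$ approximates $f$ with one-sided error and advantage $\epsilon$ if $\phi^{-1}(1)\subseteq f^{-1}(1)$ and $\Pr_{x\sim f^{-1}(1)}[\phi(x)=1]\ge\epsilon$, where $x$ is uniform on $f^{-1}(1)$. *)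

theory Defs
  imports "HOL-Probability.Probability"
begin

definition cube :: "nat \<Rightarrow> bool list set" where
  "cube n = {x. length x = n}"

text \<open>A Boolean function on the cube is a function on all Boolean lists of which only the
  values on \<^term>\<open>cube n\<close> are ever used.\<close>

definition ones :: "nat \<Rightarrow> (bool list \<Rightarrow> bool) \<Rightarrow> bool list set" where
  "ones n f = {x \<in> cube n. f x}"

datatype literal = Pos (var: nat) | Neg (var: nat)

fun lit_true :: "bool list \<Rightarrow> literal \<Rightarrow> bool" where
  "lit_true x (Pos i) \<longleftrightarrow> x ! i"
| "lit_true x (Neg i) \<longleftrightarrow> \<not> x ! i"

type_synonym clause = "literal set"
type_synonym cnf = "clause set"

text \<open>The empty clause is false and the empty formula is true. Clauses may be tautological.\<close>

definition is_cnf :: "nat \<Rightarrow> cnf \<Rightarrow> bool" where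
  "is_cnf n \<phi> \<longleftrightarrow> finite \<phi> \<and> (\<forall>C\<in>\<phi>. finite C \<and> (\<forall>l\<in>C. var l < n))"

definition cnf_true :: "cnf \<Rightarrow> bool list \<Rightarrow> bool" where
  "cnf_true \<phi> x \<longleftrightarrow> (\<forall>C\<in>\<phi>. \<exists>l\<in>C. lit_true x l)"

definition cnf_size :: "cnf \<Rightarrow> nat" where
  "cnf_size \<phi> = card \<phi>"

text \<open>Meaningful only if \<^term>\<open>ones n f\<close> is nonempty; otherwise \<^const>\<open>pmf_of_set\<close> is
  unspecified.\<close>

definition approximates_one_sided ::
    "nat \<Rightarrow> cnf \<Rightarrow> (bool list \<Rightarrow> bool) \<Rightarrow> real \<Rightarrow> bool" where
  "approximates_one_sided n \<phi> f \<epsilon> \<longleftrightarrow>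
     ones n (cnf_true \<phi>) \<subseteq> ones n f \<and>
     measure_pmf.prob (pmf_of_set (ones n f)) {x. cnf_true \<phi> x} \<ge> \<epsilon>"

end

theory Submission imports Defs begin

text \<open>
  Upper bound: write \<open>x = y @ u\<close> with \<open>y\<close> of length \<open>m = n div 2\<close>, fix \<open>z\<close> of length \<open>m\<close>, and let
  \<open>T\<close> consist of the ones of \<open>f\<close> for which \<open>y\<close> differs from \<open>z\<close> in exactly one bit. The condition
  on \<open>y\<close> costs at most \<open>2 ^ m\<close> clauses. The Hamming sphere around \<open>z\<close> is shattered by clauses, so
  for each \<open>u\<close> one further clause removes all zeros of \<open>f\<close>. Averaging over \<open>z\<close>, some \<open>T\<close>
  contains at least a fraction \<open>m / 2 ^ m\<close> of the ones of \<open>f\<close>.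

  Lower bound: there are at most \<open>2 ^ (2 * n * c)\<close> formulas with \<open>c\<close> clauses, and a fixed set of
  \<open>32 * n * c\<close> points lies in a random subset of the cube with probability \<open>2 ^ (-32 * n * c)\<close>. Hence
  some \<open>f\<close> that is true on at least half of the cube contains the ones of no formula with
  \<open>c\<close> clauses and that many satisfying assignments.
\<close>

section \<open>Size of the cube, and the advantage as a ratio of cardinalities\<close>

lemma cube_eq_lists: "cube n = {x. set x \<subseteq> UNIV \<and> length x = n}"
  by (simp add: cube_def)

lemma finite_cube [simp]: "finite (cube n)"
  unfolding cube_eq_lists by (rule finite_lists_length_eq) simp

lemma card_cube: "card (cube n) = 2 ^ n"
  unfolding cube_eq_lists by (subst card_lists_length_eq) simp_all

lemma ones_subset_cube: "ones n f \<subseteq> cube n"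
  by (auto simp: ones_def)

lemma finite_ones [simp]: "finite (ones n f)"
  by (rule finite_subset[OF ones_subset_cube finite_cube])

text \<open>Under the containment, the ones of \<open>f\<close> that satisfy \<phi> are all the ones
  of \<phi>. Nonemptiness gives \<open>pmf_of_set\<close> its meaning.\<close>

lemma approximates_one_sided_iff:
  assumes "ones n f \<noteq> {}"
  shows "approximates_one_sided n \<phi> f \<epsilon> \<longleftrightarrow>
    ones n (cnf_true \<phi>) \<subseteq> ones n f \<and>
    \<epsilon> \<le> real (card (ones n (cnf_true \<phi>))) / real (card (ones n f))"
proof -
  have "ones n f \<inter> {x. cnf_true \<phi> x} = ones n (cnf_true \<phi>)"
    if "ones n (cnf_true \<phi>) \<subseteq> ones n f"
    using that by (auto simp: ones_def)
  then show ?thesis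
    using assms by (auto simp: approximates_one_sided_def measure_pmf_of_set)
qed

section \<open>Upper bound\<close>

definition flip :: "nat \<Rightarrow> bool list \<Rightarrow> bool list" where
  "flip i z = z[i := \<not> z ! i]"

lemma length_flip [simp]: "length (flip i z) = length z"
  by (simp add: flip_def)

lemma flip_flip: "flip i (flip i z) = z"
  by (cases "i < length z") (simp_all add: flip_def list_update_beyond)

lemma nth_flip: "j < length z \<Longrightarrow> flip i z ! j \<longleftrightarrow> (if i = j then \<not> z ! j else z ! j)"
  by (simp add: flip_def)

lemma inj_on_flip: "inj_on (\<lambda>i. flip i z) {..<length z}"
  by (rule inj_onI) (metis lessThan_iff nth_flip)

definition lit :: "bool \<Rightarrow> nat \<Rightarrow> literal" where
  "lit b i = (if b then Pos i else Neg i)"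

lemma var_lit [simp]: "var (lit b i) = i"
  by (simp add: lit_def)

lemma lit_true_lit [simp]: "lit_true x (lit b i) \<longleftrightarrow> x ! i = b"
  by (simp add: lit_def)

text \<open>The full-width clause on the block of variables starting at \<open>k\<close>; its only
  falsifying assignment is \<open>y\<close>.\<close>

definition differ :: "nat \<Rightarrow> bool list \<Rightarrow> clause" where
  "differ k y = (\<lambda>i. lit (\<not> y ! i) (k + i)) ` {..<length y}"

lemma differ_true_iff:
  shows "length y' = length y \<Longrightarrow> (\<exists>l\<in>differ 0 y. lit_true (y' @ u') l) \<longleftrightarrow> y' \<noteq> y"
    and "length u' = length u \<Longrightarrow>
      (\<exists>l\<in>differ (length y') u. lit_true (y' @ u') l) \<longleftrightarrow> u' \<noteq> u"
  by (auto simp: differ_def list_eq_iff_nth_eq nth_append)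

text \<open>The first clauses exclude every prefix off the sphere around \<open>z\<close>. The
  clause for \<open>u\<close> holds automatically when the suffix is not \<open>u\<close>. Otherwise
  its prefix literals, each true where the prefix deviates from \<open>z\<close>, admit from the
  sphere exactly those \<open>flip i z\<close> for which \<open>f (flip i z @ u)\<close>
  holds.\<close>

definition flip_cnf :: "nat \<Rightarrow> nat \<Rightarrow> bool list \<Rightarrow> (bool list \<Rightarrow> bool) \<Rightarrow> cnf" where
  "flip_cnf m k z f =
     differ 0 ` (cube m - (\<lambda>i. flip i z) ` {..<m}) \<union>
     (\<lambda>u. differ m u \<union> (\<lambda>i. lit (\<not> z ! i) i) ` {i. i < m \<and> f (flip i z @ u)}) ` cube k"

lemma is_cnf_flip_cnf: "is_cnf (m + k) (flip_cnf m k z f)"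
proof -
  have "length y = n" if "y \<in> cube n" for y n
    using that by (simp add: cube_def)
  then show ?thesis
    by (auto simp: is_cnf_def flip_cnf_def differ_def)
qed

lemma cnf_size_flip_cnf: "cnf_size (flip_cnf m k z f) \<le> 2 ^ m + 2 ^ k"
proof -
  have "card (differ 0 ` (cube m - (\<lambda>i. flip i z) ` {..<m})) \<le> 2 ^ m"
    by (metis card_cube card_image_le card_mono Diff_subset finite_Diff finite_cube le_trans)
  moreover have "card ((\<lambda>u. differ m u \<union> (\<lambda>i. lit (\<not> z ! i) i) ` {i. i < m \<and> f (flip i z @ u)}) ` cube k)
      \<le> 2 ^ k"
    by (metis (no_types, lifting) card_cube card_image_le finite_cube)
  ultimately show ?thesis
    unfolding cnf_size_def flip_cnf_def
    by (meson add_mono card_Un_le le_trans)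
qed

lemma cnf_true_flip_cnf:
  assumes "length y = m" "length u = k" "length z = m"
  shows "cnf_true (flip_cnf m k z f) (y @ u) \<longleftrightarrow> f (y @ u) \<and> y \<in> (\<lambda>i. flip i z) ` {..<m}"
proof -
  let ?G = "\<lambda>u'. \<exists>i<m. f (flip i z @ u') \<and> y ! i \<noteq> z ! i"
  have 1: "(\<forall>C\<in>differ 0 ` (cube m - (\<lambda>i. flip i z) ` {..<m}). \<exists>l\<in>C. lit_true (y @ u) l)
      \<longleftrightarrow> y \<in> (\<lambda>i. flip i z) ` {..<m}"
    using assms(1) by (auto simp: differ_true_iff cube_def)
  have "(\<exists>l\<in>differ m u' \<union> (\<lambda>i. lit (\<not> z ! i) i) ` {i. i < m \<and> f (flip i z @ u')}. lit_true (y @ u) l)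
      \<longleftrightarrow> u \<noteq> u' \<or> ?G u'" if "length u' = k" for u'
    using assms that differ_true_iff(2)[of u u' y] by (auto simp: nth_append bex_Un)
  then have 2: "(\<forall>C\<in>(\<lambda>u. differ m u \<union> (\<lambda>i. lit (\<not> z ! i) i) ` {i. i < m \<and> f (flip i z @ u)}) ` cube k.
      \<exists>l\<in>C. lit_true (y @ u) l) \<longleftrightarrow> ?G u"
    using assms(2) by (auto simp: cube_def)
  \<comment> \<open>A point of the sphere deviates from \<open>z\<close> in a single position, so
    only that index can witness \<open>?G u\<close>.\<close>
  have 3: "?G u \<longleftrightarrow> f (y @ u)" if "y \<in> (\<lambda>i. flip i z) ` {..<m}"
    using that assms by (auto simp: nth_flip split: if_splits)
  show ?thesis
    unfolding cnf_true_def flip_cnf_def ball_Un 1 2 using 3 by blast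
qed

text \<open>Flipping is an involution, so membership in the sphere is symmetric. With
  \<open>z\<close> in the sphere around the prefix of \<open>x\<close>, the centres can be counted
  for fixed \<open>x\<close>.\<close>

lemma ones_flip_cnf:
  assumes "length z = m"
  shows "ones (m + k) (cnf_true (flip_cnf m k z f)) =
    {x \<in> ones (m + k) f. z \<in> (\<lambda>i. flip i (take m x)) ` {..<m}}"
proof -
  have "cnf_true (flip_cnf m k z f) x \<longleftrightarrow> f x \<and> z \<in> (\<lambda>i. flip i (take m x)) ` {..<m}"
    if "length x = m + k" for x
  proof -
    have "cnf_true (flip_cnf m k z f) (take m x @ drop m x) \<longleftrightarrow>
        f (take m x @ drop m x) \<and> take m x \<in> (\<lambda>i. flip i z) ` {..<m}"
      using that assms by (intro cnf_true_flip_cnf) auto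
    moreover have "take m x \<in> (\<lambda>i. flip i z) ` {..<m} \<longleftrightarrow> z \<in> (\<lambda>i. flip i (take m x)) ` {..<m}"
      using flip_flip by (auto intro!: image_eqI[OF sym])
    ultimately show ?thesis by simp
  qed
  then show ?thesis by (auto simp: ones_def cube_def)
qed

text \<open>Double counting of pairs of a centre \<open>z\<close> and a one \<open>x\<close>: each
  \<open>x\<close> is kept for exactly \<open>m\<close> of the \<open>2 ^ m\<close> centres, so some
  centre does at least as well as the average.\<close>

lemma exists_large_flip_cnf:
  obtains z where "length z = m"
    "m * card (ones (m + k) f) \<le> 2 ^ m * card (ones (m + k) (cnf_true (flip_cnf m k z f)))"
proof -
  let ?S = "ones (m + k) f"
  let ?T = "\<lambda>z. ones (m + k) (cnf_true (flip_cnf m k z f))"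
  let ?E = "\<lambda>x. (\<lambda>i. flip i (take m x)) ` {..<m}"
  have E: "card {z \<in> cube m. z \<in> ?E x} = m" if "x \<in> ?S" for x
  proof -
    have l: "length (take m x) = m" using that by (auto simp: ones_def cube_def)
    then have "{z \<in> cube m. z \<in> ?E x} = ?E x" by (auto simp: cube_def)
    then show ?thesis using inj_on_flip[of "take m x"] l by (simp add: card_image)
  qed
  have "(\<Sum>z\<in>cube m. card (?T z)) = (\<Sum>z\<in>cube m. card {x \<in> ?S. z \<in> ?E x})"
    by (intro sum.cong refl arg_cong[of _ _ card] ones_flip_cnf) (simp add: cube_def)
  also have "\<dots> = (\<Sum>x\<in>?S. card {z \<in> cube m. z \<in> ?E x})"
    using sum.swap_restrict[of "cube m" ?S "\<lambda>_ _. 1::nat" "\<lambda>z x. z \<in> ?E x"] by simp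
  also have "\<dots> = m * card ?S"
    using E by simp
  finally have sum: "(\<Sum>z\<in>cube m. card (?T z)) = m * card ?S" .
  have "\<exists>z\<in>cube m. m * card ?S \<le> 2 ^ m * card (?T z)"
  proof (rule ccontr)
    assume "\<not> ?thesis"
    \<comment> \<open>If every centre fell below the average, summing would give a strict inequality
      between two equal totals.\<close>
    then have "(\<Sum>z\<in>cube m. 2 ^ m * card (?T z)) < (\<Sum>z\<in>cube m. m * card ?S)"
      using card_cube[of m] by (intro sum_strict_mono) (auto simp: not_le)
    then show False
      by (simp add: sum card_cube flip: sum_distrib_left)
  qed
  then show thesis using that by (auto simp: cube_def)
qed

lemma upper_bound:
  assumes "n \<ge> 2" and S: "ones n f \<noteq> {}"
  shows "\<exists>\<epsilon>::real. 0 < \<epsilon> \<and> \<epsilon> \<le> 1 \<and>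
    (\<exists>\<phi>. is_cnf n \<phi> \<and> real (cnf_size \<phi>) \<le> \<epsilon> * 2 ^ (n + 3) / real n \<and>
       approximates_one_sided n \<phi> f \<epsilon>)"
proof -
  define m where "m = n div 2"
  define k where "k = n - m"
  \<comment> \<open>\<open>m \<le> k\<close> lets \<open>2 ^ k\<close> dominate both groups of
    clauses. Halving loses at most a factor 4 against \<open>n\<close>, the worst ratio being at
    \<open>n = 3\<close>.\<close>
  have n: "n = m + k" and mk: "m \<le> k" "0 < m" "n \<le> 4 * m"
    using assms(1) by (auto simp: m_def k_def)
  obtain z where z: "length z = m"
    "m * card (ones n f) \<le> 2 ^ m * card (ones n (cnf_true (flip_cnf m k z f)))"
    using exists_large_flip_cnf[of m k f] unfolding n by blast
  define \<phi> where "\<phi> = flip_cnf m k z f"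
  \<comment> \<open>The exact fraction of ones kept, at least \<open>m / 2 ^ m\<close>.\<close>
  define \<epsilon> where "\<epsilon> = real (card (ones n (cnf_true \<phi>))) / real (card (ones n f))"
  have sub: "ones n (cnf_true \<phi>) \<subseteq> ones n f"
    unfolding \<phi>_def n ones_flip_cnf[OF z(1)] by blast
  have Spos: "0 < card (ones n f)"
    using S by (simp add: card_gt_0_iff)
  have "real (m * card (ones n f)) \<le> real (2 ^ m * card (ones n (cnf_true \<phi>)))"
    using z(2) unfolding \<phi>_def by (simp only: of_nat_le_iff)
  then have eps: "real m \<le> 2 ^ m * \<epsilon>"
    using Spos by (simp add: \<epsilon>_def field_simps)
  then have "0 < 2 ^ m * \<epsilon>" using mk(2) by linarith
  then have "0 < \<epsilon>" by (simp add: zero_less_mult_iff)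
  moreover have "\<epsilon> \<le> 1"
    using Spos card_mono[OF finite_ones sub] by (simp add: \<epsilon>_def)
  moreover have "real (cnf_size \<phi>) \<le> \<epsilon> * 2 ^ (n + 3) / real n"
  proof -
    have "(2::nat) ^ m \<le> 2 ^ k" using mk(1) by simp
    then have "cnf_size \<phi> \<le> 2 * 2 ^ k"
      using cnf_size_flip_cnf[of m k z f] unfolding \<phi>_def by linarith
    then have "real (cnf_size \<phi>) \<le> 2 * 2 ^ k"
      by (metis of_nat_le_iff of_nat_mult of_nat_numeral of_nat_power)
    \<comment> \<open>The factor 2 for the two groups of clauses and the 4 from
      \<open>n \<le> 4 * m\<close> make up the \<open>2 ^ 3\<close> of the bound.\<close>
    then have "real (cnf_size \<phi>) * n \<le> 2 * 2 ^ k * (4 * real m)"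
      using mk(3) by (intro mult_mono) auto
    also have "\<dots> \<le> 2 * 2 ^ k * (4 * (2 ^ m * \<epsilon>))"
      using eps by simp
    also have "\<dots> = \<epsilon> * 2 ^ (n + 3)"
      by (simp add: n power_add)
    finally show ?thesis using assms(1) by (simp add: field_simps)
  qed
  moreover have "is_cnf n \<phi>"
    unfolding n \<phi>_def by (rule is_cnf_flip_cnf)
  moreover have "approximates_one_sided n \<phi> f \<epsilon>"
    using S sub by (simp add: approximates_one_sided_iff \<epsilon>_def)
  ultimately show ?thesis by blast
qed

section \<open>Lower bound\<close>

text \<open>A set or its complement contains at least half of \<open>A\<close>, so the large sets
  and their complements cover the power set.\<close>

lemma card_large_subsets:
  assumes "finite A"
  shows "2 ^ card A \<le> 2 * card {S. S \<subseteq> A \<and> card A \<le> 2 * card S}"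
proof -
  let ?F = "{S. S \<subseteq> A \<and> card A \<le> 2 * card S}"
  have fin: "finite ?F" using assms by simp
  have "Pow A \<subseteq> ?F \<union> (\<lambda>S. A - S) ` ?F"
  proof
    fix S assume "S \<in> Pow A"
    then have S: "S \<subseteq> A" "finite S" using assms finite_subset by auto
    show "S \<in> ?F \<union> (\<lambda>S. A - S) ` ?F"
    proof (cases "card A \<le> 2 * card S")
      case False
      then have "A - S \<in> ?F" using S by (auto simp: card_Diff_subset)
      moreover have "S = A - (A - S)" using S by blast
      ultimately show ?thesis by blast
    qed (use S in auto)
  qed
  then have "card (Pow A) \<le> card (?F \<union> (\<lambda>S. A - S) ` ?F)"
    using fin by (intro card_mono) auto
  also have "\<dots> \<le> card ?F + card ((\<lambda>S. A - S) ` ?F)"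
    by (rule card_Un_le)
  also have "\<dots> \<le> card ?F + card ?F"
    using card_image_le[OF fin] by simp
  finally show ?thesis using assms by (simp add: card_Pow)
qed

text \<open>A superset of \<open>T\<close> is a free choice outside \<open>T\<close>: a random
  subset of \<open>A\<close> contains \<open>T\<close> with probability
  \<open>2 ^ (- card T)\<close>, written without division.\<close>

lemma card_supersets:
  assumes "finite A" "T \<subseteq> A"
  shows "card {S. T \<subseteq> S \<and> S \<subseteq> A} * 2 ^ card T = 2 ^ card A"
proof -
  have "bij_betw (\<lambda>S. S - T) {S. T \<subseteq> S \<and> S \<subseteq> A} (Pow (A - T))"
    by (rule bij_betwI[where g = "\<lambda>S. S \<union> T"]) (use assms in auto)
  then have "card {S. T \<subseteq> S \<and> S \<subseteq> A} = 2 ^ card (A - T)"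
    using assms by (simp add: bij_betw_same_card card_Pow)
  moreover have "card (A - T) + card T = card A"
    using assms by (metis card_Diff_subset card_mono finite_subset le_add_diff_inverse2)
  ultimately show ?thesis by (simp flip: power_add)
qed

section \<open>Counting formulas by their number of clauses\<close>

definition literals :: "nat \<Rightarrow> literal set" where
  "literals n = {l. var l < n}"

lemma literals_eq: "literals n = Pos ` {..<n} \<union> Neg ` {..<n}"
proof -
  have "l \<in> Pos ` {..<n} \<union> Neg ` {..<n}" if "var l < n" for l
    using that by (cases l) auto
  then show ?thesis by (auto simp: literals_def)
qed

lemma finite_literals [simp]: "finite (literals n)"
  by (simp add: literals_eq)

lemma card_literals: "card (literals n) = 2 * n"
  unfolding literals_eq by (subst card_Un_disjoint) (auto simp: card_image inj_on_def)

lemma is_cnf_iff: "is_cnf n \<phi> \<longleftrightarrow> \<phi> \<subseteq> Pow (literals n)"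
proof
  assume "\<phi> \<subseteq> Pow (literals n)"
  moreover from this have "finite \<phi>"
    by (rule finite_subset) simp
  moreover have "finite C" if "C \<in> \<phi>" for C
    using calculation(1) that by (intro finite_subset[OF _ finite_literals[of n]]) auto
  ultimately show "is_cnf n \<phi>"
    by (auto simp: is_cnf_def literals_def)
qed (auto simp: is_cnf_def literals_def)

text \<open>Formulas with \<open>c\<close> clauses are the \<open>c\<close>-element subsets of the
  \<open>2 ^ (2 * n)\<close> sets of literals, and a binomial coefficient is at most the
  corresponding power.\<close>

lemma card_cnfs_of_size: "card {\<phi>. is_cnf n \<phi> \<and> cnf_size \<phi> = c} \<le> 2 ^ (2 * n * c)"
proof -
  have "card {\<phi>. is_cnf n \<phi> \<and> cnf_size \<phi> = c} = (2 ^ (2 * n) choose c)"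
    unfolding is_cnf_iff cnf_size_def
    by (subst n_subsets) (simp_all add: card_Pow card_literals)
  also have "\<dots> \<le> (2 ^ (2 * n)) ^ c"
  proof (cases "c \<le> 2 ^ (2 * n)")
    case True
    then show ?thesis by (rule binomial_le_pow)
  qed (simp add: binomial_eq_0)
  finally show ?thesis by (simp add: power_mult)
qed

lemma finite_cnfs [simp]: "finite {\<phi>. is_cnf n \<phi> \<and> P \<phi>}"
  unfolding is_cnf_iff by (rule finite_subset[of _ "Pow (Pow (literals n))"]) auto

lemma cnf_size_le: "is_cnf n \<phi> \<Longrightarrow> cnf_size \<phi> \<le> 2 ^ (2 * n)"
  unfolding is_cnf_iff cnf_size_def
  by (metis card_Pow card_literals card_mono finite_Pow_iff finite_literals)

text \<open>A union bound over all formulas. The \<open>max\<close> gives the empty formula a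
  positive threshold; with threshold 0 it would count as bad, and the exponent gap would vanish at
  size 0.\<close>

lemma exists_hard_set:
  assumes n: "n \<ge> 1"
  obtains S where "S \<subseteq> cube n" "2 ^ n \<le> 2 * card S"
    "\<And>\<phi>. is_cnf n \<phi> \<Longrightarrow> ones n (cnf_true \<phi>) \<subseteq> S \<Longrightarrow>
       card (ones n (cnf_true \<phi>)) < 32 * n * max (cnf_size \<phi>) 1"
proof -
  let ?T = "\<lambda>\<phi>. ones n (cnf_true \<phi>)"
  let ?N = "2 ^ n :: nat"
  \<comment> \<open>\<Phi> collects the formulas of size \<open>c\<close> with too many satisfying
    assignments, \<open>U\<close> the sets that such a formula spoils, and \<open>B\<close> all
    spoiled sets.\<close>
  define \<Phi> where "\<Phi> c = {\<phi>. is_cnf n \<phi> \<and> cnf_size \<phi> = c \<and> 32 * n * max c 1 \<le> card (?T \<phi>)}" for c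
  define U where "U \<phi> = {S. ?T \<phi> \<subseteq> S \<and> S \<subseteq> cube n}" for \<phi>
  define B where "B = (\<Union>c\<le>2 ^ (2 * n). \<Union>\<phi>\<in>\<Phi> c. U \<phi>)"
  let ?F = "{S. S \<subseteq> cube n \<and> card (cube n) \<le> 2 * card S}"
  have fin_\<Phi>: "finite (\<Phi> c)" for c
    unfolding \<Phi>_def by simp
  have fin_U: "finite (U \<phi>)" for \<phi>
    unfolding U_def by (rule finite_subset[of _ "Pow (cube n)"]) auto
  \<comment> \<open>There are at most \<open>2 ^ (2 * n * ?d)\<close> formulas, each spoiling a
    fraction of at most \<open>2 ^ (-32 * n * ?d)\<close> of the subsets. Since
    \<open>?d \<ge> 1\<close>, the gap in the exponent is at least \<open>30 * n\<close>, uniformly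
    in \<open>c\<close>.\<close>
  have per_size: "card (\<Union>\<phi>\<in>\<Phi> c. U \<phi>) * 2 ^ (30 * n) \<le> 2 ^ ?N" for c
  proof -
    let ?d = "max c 1"
    have U: "card (U \<phi>) * 2 ^ (32 * n * ?d) \<le> 2 ^ ?N" if "\<phi> \<in> \<Phi> c" for \<phi>
    proof -
      have "card (U \<phi>) * 2 ^ (32 * n * ?d) \<le> card (U \<phi>) * 2 ^ card (?T \<phi>)"
        using that by (intro mult_left_mono power_increasing) (auto simp: \<Phi>_def)
      also have "\<dots> = 2 ^ ?N"
        unfolding U_def by (simp add: card_supersets ones_subset_cube card_cube)
      finally show ?thesis .
    qed
    have "card (\<Phi> c) \<le> card {\<phi>. is_cnf n \<phi> \<and> cnf_size \<phi> = c}"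
      by (intro card_mono finite_cnfs) (auto simp: \<Phi>_def)
    also have "\<dots> \<le> 2 ^ (2 * n * c)" by (rule card_cnfs_of_size)
    also have "\<dots> \<le> 2 ^ (2 * n * ?d)" by (intro power_increasing mult_left_mono) auto
    finally have card_\<Phi>: "card (\<Phi> c) \<le> 2 ^ (2 * n * ?d)" .
    have "card (\<Union>\<phi>\<in>\<Phi> c. U \<phi>) * 2 ^ (32 * n * ?d) \<le> (\<Sum>\<phi>\<in>\<Phi> c. card (U \<phi>)) * 2 ^ (32 * n * ?d)"
      by (intro mult_right_mono card_UN_le fin_\<Phi>) simp
    also have "\<dots> \<le> card (\<Phi> c) * 2 ^ ?N"
      unfolding sum_distrib_right using sum_bounded_above[OF U, of "\<Phi> c"] by simp
    also have "\<dots> \<le> 2 ^ (2 * n * ?d) * 2 ^ ?N"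
      using card_\<Phi> by (rule mult_right_mono) simp
    finally have "2 ^ (2 * n * ?d) * (card (\<Union>\<phi>\<in>\<Phi> c. U \<phi>) * 2 ^ (30 * n * ?d)) \<le> 2 ^ (2 * n * ?d) * 2 ^ ?N"
      by (simp add: algebra_simps flip: power_add)
    then have "card (\<Union>\<phi>\<in>\<Phi> c. U \<phi>) * 2 ^ (30 * n * ?d) \<le> 2 ^ ?N"
      by simp
    moreover have "card (\<Union>\<phi>\<in>\<Phi> c. U \<phi>) * 2 ^ (30 * n) \<le> card (\<Union>\<phi>\<in>\<Phi> c. U \<phi>) * 2 ^ (30 * n * ?d)"
      by (intro mult_left_mono power_increasing) auto
    ultimately show ?thesis by linarith
  qed
  have "card B * 2 ^ (30 * n) \<le> (\<Sum>c\<le>2 ^ (2 * n). card (\<Union>\<phi>\<in>\<Phi> c. U \<phi>)) * 2 ^ (30 * n)"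
    unfolding B_def by (intro mult_right_mono card_UN_le) auto
  also have "\<dots> \<le> (2 ^ (2 * n) + 1) * 2 ^ ?N"
    unfolding sum_distrib_right
    using sum_bounded_above[of "{..2 ^ (2 * n)}" "\<lambda>c. card (\<Union>\<phi>\<in>\<Phi> c. U \<phi>) * 2 ^ (30 * n)", OF per_size]
    by simp
  \<comment> \<open>Summing over all possible sizes costs at most another \<open>3 * n\<close> in
    the exponent.\<close>
  also have "\<dots> \<le> 2 ^ (3 * n) * 2 ^ ?N"
  proof (rule mult_right_mono)
    have "(2::nat) ^ (2 * n) + 1 \<le> 2 ^ (2 * n) * 2" by simp
    also have "\<dots> \<le> 2 ^ (2 * n) * 2 ^ n" using power_increasing[OF n, of "2::nat"] by simp
    finally show "(2::nat) ^ (2 * n) + 1 \<le> 2 ^ (3 * n)" by (simp flip: power_add)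
  qed simp
  finally have "2 ^ (3 * n) * (card B * 2 ^ (27 * n)) \<le> 2 ^ (3 * n) * 2 ^ ?N"
    by (simp add: algebra_simps flip: power_add)
  then have "card B * 2 ^ (27 * n) \<le> 2 ^ ?N"
    by simp
  moreover have "card B * 4 \<le> card B * 2 ^ (27 * n)"
    using n power_increasing[of 2 "27 * n" "2::nat"] by (intro mult_left_mono) auto
  \<comment> \<open>At most a quarter of all subsets are spoiled, while at least half are
    large.\<close>
  ultimately have "card B * 4 \<le> 2 ^ ?N"
    by (rule le_trans[rotated])
  moreover have "2 ^ ?N \<le> 2 * card ?F"
    using card_large_subsets[of "cube n"] by (simp add: card_cube)
  moreover have "0 < (2::nat) ^ ?N" by simp
  ultimately have "card B < card ?F"
    by linarith
  moreover have "finite B"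
    unfolding B_def using fin_\<Phi> fin_U by auto
  ultimately have "\<not> ?F \<subseteq> B"
    using card_mono[of B ?F] by linarith
  then obtain S where S: "S \<subseteq> cube n" "card (cube n) \<le> 2 * card S" "S \<notin> B"
    by blast
  show thesis
  proof
    fix \<phi> assume \<phi>: "is_cnf n \<phi>" "?T \<phi> \<subseteq> S"
    show "card (?T \<phi>) < 32 * n * max (cnf_size \<phi>) 1"
    proof (rule ccontr)
      assume "\<not> ?thesis"
      then have "\<phi> \<in> \<Phi> (cnf_size \<phi>)" "S \<in> U \<phi>"
        using \<phi> S(1) by (auto simp: \<Phi>_def U_def)
      then have "S \<in> B"
        unfolding B_def using cnf_size_le[OF \<phi>(1)] by blast
      then show False using S(3) by simp
    qed
  qed (use S in \<open>simp_all add: card_cube\<close>)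
qed

text \<open>Take the indicator of a hard set \<open>S\<close>. An approximating formula accepts at
  least \<epsilon> \<open>* card S\<close> points, all inside \<open>S\<close>, so hardness forces
  it to have many clauses.\<close>

lemma lower_bound:
  assumes n: "n \<ge> 1" "32 * n \<le> 2 ^ n"
  shows "\<exists>f. ones n f \<noteq> {} \<and>
    (\<forall>\<epsilon>::real. 0 < \<epsilon> \<and> \<epsilon> \<le> 1 \<longrightarrow>
      (\<forall>\<phi>. is_cnf n \<phi> \<and> approximates_one_sided n \<phi> f \<epsilon> \<longrightarrow>
         real (cnf_size \<phi>) \<ge> \<epsilon> * 2 powr (real n - 7) / real n))"
proof -
  obtain S where S: "S \<subseteq> cube n" "2 ^ n \<le> 2 * card S"
    and hard: "\<And>\<phi>. is_cnf n \<phi> \<Longrightarrow> ones n (cnf_true \<phi>) \<subseteq> S \<Longrightarrow>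
       card (ones n (cnf_true \<phi>)) < 32 * n * max (cnf_size \<phi>) 1"
    using exists_hard_set[OF n(1)] by blast
  have ones: "ones n (\<lambda>x. x \<in> S) = S"
    using S(1) by (auto simp: ones_def)
  have "0 < card S"
    using S(2) by (metis gr0I mult_0_right not_le zero_less_numeral zero_less_power)
  then have ne: "ones n (\<lambda>x. x \<in> S) \<noteq> {}"
    unfolding ones by auto
  have "real (cnf_size \<phi>) \<ge> \<epsilon> * 2 powr (real n - 7) / real n"
    if \<epsilon>: "0 < \<epsilon>" and \<phi>: "is_cnf n \<phi>" "approximates_one_sided n \<phi> (\<lambda>x. x \<in> S) \<epsilon>" for \<epsilon> \<phi>
  proof -
    let ?T = "ones n (cnf_true \<phi>)"
    have T: "?T \<subseteq> S" "\<epsilon> \<le> real (card ?T) / real (card S)"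
      using \<phi>(2) ne by (simp_all add: approximates_one_sided_iff ones)
    \<comment> \<open>The empty formula accepts the whole cube, and
      \<open>32 * n \<le> 2 ^ n\<close> contradicts hardness.\<close>
    have "cnf_size \<phi> \<noteq> 0"
    proof
      assume 0: "cnf_size \<phi> = 0"
      then have "\<phi> = {}" using \<phi>(1) by (simp add: cnf_size_def is_cnf_def)
      then have "?T = cube n" by (simp add: ones_def cnf_true_def)
      then show False using hard[OF \<phi>(1) T(1)] 0 n(2) by (simp add: card_cube)
    qed
    then have "max (cnf_size \<phi>) 1 = cnf_size \<phi>"
      by simp
    then have "card ?T \<le> 32 * n * cnf_size \<phi>"
      using hard[OF \<phi>(1) T(1)] by simp
    then have "real (card ?T) \<le> real (32 * n * cnf_size \<phi>)"
      by (simp only: of_nat_le_iff)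
    moreover have "\<epsilon> * real (card S) \<le> real (card ?T)"
      using T(2) \<open>0 < card S\<close> by (simp add: pos_le_divide_eq)
    moreover have "real (2 ^ n) \<le> real (2 * card S)"
      using S(2) by (simp only: of_nat_le_iff)
    then have "\<epsilon> * 2 ^ n \<le> \<epsilon> * (2 * real (card S))"
      using \<epsilon> by (intro mult_left_mono) auto
    ultimately have "\<epsilon> * 2 ^ n \<le> 64 * (real n * real (cnf_size \<phi>))"
      by simp
    \<comment> \<open>The constant obtained is \<open>64 = 2 ^ 6\<close>: 32 from hardness and 2
      from the density of \<open>S\<close>. It is relaxed to the claimed
      \<open>2 ^ 7\<close>.\<close>
    also have "\<dots> \<le> 128 * (real n * real (cnf_size \<phi>))"
      by (intro mult_right_mono) simp_all
    finally have "\<epsilon> * (2 ^ n / 128) \<le> real (cnf_size \<phi>) * real n"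
      by (simp add: mult.commute)
    moreover have "2 powr (real n - 7) = 2 ^ n / (128::real)"
      by (simp add: powr_diff powr_realpow)
    ultimately have "\<epsilon> * 2 powr (real n - 7) \<le> real (cnf_size \<phi>) * real n"
      by metis
    then show ?thesis
      using n(1) by (simp add: pos_divide_le_eq)
  qed
  then show ?thesis using ne by blast
qed

text \<open>Both sides equal 256 at \<open>n = 8\<close>, whence the threshold 8 for "sufficiently
  large".\<close>

lemma le_two_power: "n \<ge> 8 \<Longrightarrow> 32 * n \<le> (2::nat) ^ n"
  by (induction n rule: nat_induct_at_least) auto

theorem theorem5p1:
  "\<forall>\<^sub>F n :: nat in sequentially.
     (\<forall>f. ones n f \<noteq> {} \<longrightarrow>
        (\<exists>\<epsilon>::real. 0 < \<epsilon> \<and> \<epsilon> \<le> 1 \<and>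
          (\<exists>\<phi>. is_cnf n \<phi> \<and> real (cnf_size \<phi>) \<le> \<epsilon> * 2 ^ (n + 3) / real n \<and>
               approximates_one_sided n \<phi> f \<epsilon>))) \<and>
     (\<exists>f. ones n f \<noteq> {} \<and>
        (\<forall>\<epsilon>::real. 0 < \<epsilon> \<and> \<epsilon> \<le> 1 \<longrightarrow>
          (\<forall>\<phi>. is_cnf n \<phi> \<and> approximates_one_sided n \<phi> f \<epsilon> \<longrightarrow>
               real (cnf_size \<phi>) \<ge> \<epsilon> * 2 powr (real n - 7) / real n)))"
  unfolding eventually_sequentially
  by (intro exI[of _ 8] allI impI conjI upper_bound lower_bound le_two_power) auto

end
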